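(* Let $r>1$ be an integer and $q$ a power of an odd prime with $q\equiv 1\pmod r$; let $\zeta\in\mathbb{F}_q^{\ast}$ be an element of order $r$. Let $m,d$ be positive integers with $q-1=md$, $d$ a multiple of $r$, and $\varphi(m)\ge r$. Let $u_0,u_1,\ldots,u_{r-1}\in\mathbb{F}_q^{\ast}$ all have multiplicative order $m$. Let $G(x)=a_{r-1}x^{r-1}+\cdots+a_1x+a_0\in\mathbb{F}_q[x]$ be the (unique) polynomial of degree at most $r-1$ with $G(\zeta^k)=u_k$ for $k=0,1,\ldots,r-1$, i.e. $\sum_{s=0}^{r-1}a_s\zeta^{ks}=u_k$. Let $\ell=(q-1)/r$ and $f(x)=xG(x^{\ell})$. Then: (i) $f$ is a permutation polynomial of $\mathbb{F}_q$; (ii) the permutation induced by $f$ has cycle type $1+m^d$; (iii) the inverse permutation is induced by a polynomial of the form $xG'(x^{\ell})$ (so involving the same powers of $x$ as $f$), where $G'$ is the polynomial of degree at most $r-1$ with $G'(\zeta^k)=u_k^{-1}$ for $k=0,\ldots,r-1$.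
   Context: $\varphi$ is Euler's totient function. The order of a nonzero element means its order in $\mathbb{F}_q^{\ast}$. Cycle type $1+m^d$ means exactly one fixed point and $d$ further disjoint cycles each of length $m$. *)

theory Defs
  imports
    "HOL-Number_Theory.Totient"
    "HOL-Computational_Algebra.Polynomial"
    "HOL-Combinatorics.Orbits"
    "HOL-Library.Multiset"
    "HOL-Library.Cardinality"
begin

text \<open>Order in the multiplicative group of a finite field; meaningful only for nonzero arguments.\<close>

definition mult_order :: "'a :: {field, finite} \<Rightarrow> nat" where
  "mult_order x = (LEAST n. 0 < n \<and> x ^ n = 1)"

definition permutation_poly :: "'a :: {field, finite} poly \<Rightarrow> bool" where
  "permutation_poly f \<longleftrightarrow> bij (poly f)"

text \<open>
  The multiset of cycle lengths of a permutation of a finite type. The cycles are the orbits, and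
  fixed points count as cycles of length one.
\<close>

definition cycle_type :: "('a :: finite \<Rightarrow> 'a) \<Rightarrow> nat multiset" where
  "cycle_type \<pi> = image_mset card (mset_set (range (orbit \<pi>)))"

definition interpolates_roots :: "nat \<Rightarrow> 'a :: {field, finite} \<Rightarrow> (nat \<Rightarrow> 'a) \<Rightarrow> 'a poly \<Rightarrow> bool" where
  "interpolates_roots r \<zeta> u G \<longleftrightarrow> degree G \<le> r - 1 \<and> (\<forall>k<r. poly G (\<zeta> ^ k) = u k)"

text \<open>The polynomial \<open>x G(x\<^sup>l)\<close>.\<close>

definition x_times_poly_pow :: "nat \<Rightarrow> 'a :: {field, finite} poly \<Rightarrow> 'a poly" where
  "x_times_poly_pow l G = monom 1 1 * pcompose G (monom 1 l)"

end

theory Submission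
  imports Defs
begin

text \<open>
  For nonzero \<open>x\<close> the power \<open>x\<^sup>l\<close> is an \<open>r\<close>-th root of unity \<open>\<zeta>\<^sup>k\<close>, so that \<open>f x = u\<^sub>k x\<close>.
  Since \<open>m\<close> divides \<open>l\<close>, multiplication by \<open>u\<^sub>k\<close> does not change the \<open>l\<close>-th power, so the index \<open>k\<close> is
  constant along the orbit of \<open>x\<close> and \<open>f\<close> acts on it as multiplication by a fixed element of
  order \<open>m\<close>. Hence every nonzero orbit has length \<open>m\<close>, and \<open>f\<^sup>-\<^sup>1\<close> multiplies by \<open>u\<^sub>k\<^sup>-\<^sup>1\<close>.
\<close>

section \<open>Orders and roots of unity in a finite field\<close>

lemma finite_field_power_card_minus_1:
  fixes x :: "'a :: {field, finite}"
  assumes "x \<noteq> 0"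
  shows "x ^ (CARD('a) - 1) = 1"
proof -
  \<comment> \<open>Multiplication by \<open>x\<close> permutes the nonzero elements, so it
    preserves their product. That nonzero product can then be cancelled.\<close>
  have bij: "bij_betw ((*) x) (UNIV - {0}) (UNIV - {0})"
    using assms by (intro bij_betwI[where g = "\<lambda>y. y / x"]) auto
  have "(\<Prod>y\<in>UNIV - {0}. y) = (\<Prod>y\<in>UNIV - {0}. x * y)"
    by (rule prod.reindex_bij_betw[OF bij, symmetric])
  also have "\<dots> = x ^ (CARD('a) - 1) * (\<Prod>y\<in>UNIV - {0}. y)"
    by (simp add: prod.distrib card_Diff_singleton)
  finally show ?thesis
    by simp
qed

lemma
  fixes x :: "'a :: {field, finite}"
  assumes "x \<noteq> 0"
  shows mult_order_pos: "0 < mult_order x"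
    and power_mult_order: "x ^ mult_order x = 1"
proof -
  \<comment> \<open>This makes the exponent \<open>CARD('a) - 1\<close> positive, hence a witness
    for the \<open>LEAST\<close> in \<open>mult_order\<close>.\<close>
  have "card {0, 1 :: 'a} \<le> CARD('a)"
    by (intro card_mono) auto
  then have "0 < CARD('a) - 1 \<and> x ^ (CARD('a) - 1) = 1"
    using finite_field_power_card_minus_1[OF assms] by simp
  then have "0 < mult_order x \<and> x ^ mult_order x = 1"
    unfolding mult_order_def by (rule LeastI)
  then show "0 < mult_order x" "x ^ mult_order x = 1"
    by auto
qed

lemma mult_order_le:
  assumes "0 < n" "x ^ n = 1"
  shows "mult_order x \<le> n"
  unfolding mult_order_def using assms by (intro Least_le) auto

lemma inj_on_power_mult_order:
  fixes x :: "'a :: {field, finite}"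
  assumes "x \<noteq> 0"
  shows "inj_on (\<lambda>k. x ^ k) {..<mult_order x}"
proof (rule linorder_inj_onI)
  fix i j
  assume "i < j" "i \<in> {..<mult_order x}" "j \<in> {..<mult_order x}"
  show "x ^ i \<noteq> x ^ j"
  proof
    assume "x ^ i = x ^ j"
    also have "x ^ j = x ^ i * x ^ (j - i)"
      using \<open>i < j\<close> by (simp flip: power_add)
    finally have "x ^ (j - i) = 1"
      using assms by simp
    with \<open>i < j\<close> have "mult_order x \<le> j - i"
      by (intro mult_order_le) auto
    with \<open>j \<in> _\<close> \<open>i < j\<close> show False
      by simp
  qed
qed auto

text \<open>The polynomial \<open>X^r - 1\<close> has at most \<open>r\<close> roots, and the
  \<open>r\<close> distinct powers of \<open>z\<close> are already roots, so there are no
  others.\<close>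

lemma root_of_unity_eq_power:
  fixes z y :: "'a :: {field, finite}"
  assumes "z \<noteq> 0" and y: "y ^ mult_order z = 1"
  obtains k where "k < mult_order z" "y = z ^ k"
proof -
  define r where "r = mult_order z"
  have "r > 0"
    using mult_order_pos[OF \<open>z \<noteq> 0\<close>] by (simp add: r_def)
  define P :: "'a poly" where "P = monom 1 r + [:-1:]"
  have deg: "degree P = r"
    unfolding P_def using \<open>r > 0\<close> by (subst degree_add_eq_left) (auto simp: degree_monom_eq)
  with \<open>r > 0\<close> have "P \<noteq> 0"
    by auto
  have roots: "{w. poly P w = 0} = {w. w ^ r = 1}"
    by (simp add: P_def poly_monom)
  have "(\<lambda>k. z ^ k) ` {..<r} \<subseteq> {w. w ^ r = 1}"
  proof safe
    fix k
    have "(z ^ k) ^ r = (z ^ r) ^ k"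
      by (simp add: mult.commute flip: power_mult)
    then show "(z ^ k) ^ r = 1"
      using power_mult_order[OF \<open>z \<noteq> 0\<close>] by (simp add: r_def)
  qed
  moreover have "card {w :: 'a. w ^ r = 1} \<le> card ((\<lambda>k. z ^ k) ` {..<r})"
    using card_poly_roots_bound[OF \<open>P \<noteq> 0\<close>] inj_on_power_mult_order[OF \<open>z \<noteq> 0\<close>]
    by (simp add: roots deg card_image r_def)
  ultimately have "(\<lambda>k. z ^ k) ` {..<r} = {w. w ^ r = 1}"
    by (intro card_seteq) auto
  with y that show ?thesis
    by (auto simp: r_def image_iff set_eq_iff)
qed

section \<open>Polynomial interpolation\<close>

lemma interpolation_exists:
  fixes x y :: "nat \<Rightarrow> 'a :: field"
  assumes "inj_on x {..<n}"
  shows "\<exists>p. degree p \<le> n - 1 \<and> (\<forall>k<n. poly p (x k) = y k)"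
  using assms
proof (induction n)
  case 0
  show ?case by (intro exI[of _ 0]) auto
next
  case (Suc n)
  then obtain p where p: "degree p \<le> n - 1" "\<And>k. k < n \<Longrightarrow> poly p (x k) = y k"
    by (auto simp: lessThan_Suc)
  \<comment> \<open>Newton's scheme: \<open>w\<close> vanishes at all earlier nodes, so adding a
    multiple of it corrects the value at \<open>x n\<close> without disturbing the others.\<close>
  define w where "w = (\<Prod>k<n. [:- x k, 1:])"
  have w_roots: "poly w (x k) = 0" if "k < n" for k
    using that by (auto simp: w_def poly_prod)
  have w_nz: "poly w (x n) \<noteq> 0"
    using Suc.prems by (force simp: w_def poly_prod inj_on_def)
  have "degree w \<le> n"
    using degree_prod_sum_le[of "{..<n}" "\<lambda>k. [:- x k, 1:]"] by (simp add: w_def)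
  define p' where "p' = p + smult ((y n - poly p (x n)) / poly w (x n)) w"
  have "degree p' \<le> n"
    unfolding p'_def using p(1) \<open>degree w \<le> n\<close>
    by (intro degree_add_le) (auto intro: order.trans[OF degree_smult_le])
  moreover have "poly p' (x k) = y k" if "k < Suc n" for k
    using that p(2) w_roots w_nz by (cases "k = n") (auto simp: p'_def)
  ultimately show ?case
    by auto
qed

text \<open>The nodes are \<open>r\<close> distinct points, and since \<open>r > 0\<close> the bound
  \<open>r - 1\<close> means degree less than \<open>r\<close>; two such polynomials agreeing at all
  nodes are equal.\<close>

lemma ex1_interpolates_roots:
  fixes \<zeta> :: "'a :: {field, finite}"
  assumes "\<zeta> \<noteq> 0" "mult_order \<zeta> = r"
  shows "\<exists>!G. interpolates_roots r \<zeta> v G"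
proof -
  have inj: "inj_on (\<lambda>k. \<zeta> ^ k) {..<r}"
    using inj_on_power_mult_order[OF assms(1)] assms(2) by simp
  have "r > 0"
    using mult_order_pos[OF assms(1)] assms(2) by simp
  have "\<exists>G. interpolates_roots r \<zeta> v G"
    using interpolation_exists[OF inj] by (auto simp: interpolates_roots_def)
  moreover have "G = H" if "interpolates_roots r \<zeta> v G" "interpolates_roots r \<zeta> v H" for G H
    by (rule poly_eqI_degree[where A = "(\<lambda>k. \<zeta> ^ k) ` {..<r}"])
       (use that \<open>r > 0\<close> in \<open>auto simp: interpolates_roots_def card_image[OF inj]\<close>)
  ultimately show ?thesis
    by blast
qed

lemma poly_x_times_poly_pow: "poly (x_times_poly_pow l G) x = x * poly G (x ^ l)"
  by (simp add: x_times_poly_pow_def poly_pcompose poly_monom)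

section \<open>Maps multiplying by a factor of order \<open>m\<close> that is constant along
  orbits\<close>

context
  fixes c f :: "'a :: {field, finite} \<Rightarrow> 'a" and m :: nat
  assumes f_eq: "\<And>x. f x = c x * x"
    and c_nonzero: "\<And>x. x \<noteq> 0 \<Longrightarrow> c x \<noteq> 0"
    and c_order: "\<And>x. x \<noteq> 0 \<Longrightarrow> mult_order (c x) = m"
    and c_invariant: "\<And>x. x \<noteq> 0 \<Longrightarrow> c (c x * x) = c x"
begin

lemma multiplier_funpow:
  assumes "x \<noteq> 0"
  shows "(f ^^ n) x = c x ^ n * x"
proof -
  \<comment> \<open>The invariance of \<open>c\<close> is carried through the induction, because the
    next step multiplies by the value of \<open>c\<close> at the current iterate.\<close>
  have "(f ^^ n) x = c x ^ n * x \<and> c ((f ^^ n) x) = c x"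
  proof (induction n)
    case (Suc n)
    then have IH: "(f ^^ n) x = c x ^ n * x" "c (c x ^ n * x) = c x"
      by auto
    have "c x ^ n * x \<noteq> 0"
      using c_nonzero[OF assms] assms by simp
    from c_invariant[OF this] have "c (c x * (c x ^ n * x)) = c x"
      by (simp only: IH(2))
    then show ?case
      by (simp add: IH f_eq[of "c x ^ n * x"] mult.assoc)
  qed simp
  then show ?thesis
    by simp
qed

lemma multiplier_order_pos: "0 < m"
  using mult_order_pos[OF c_nonzero[of 1]] c_order[of 1] by simp

lemma multiplier_funpow_order: "(f ^^ m) x = x"
proof (cases "x = 0")
  case True
  have "(f ^^ n) 0 = 0" for n
    by (induction n) (auto simp: f_eq)
  with True show ?thesis
    by simp
next
  case False
  then show ?thesis
    using power_mult_order[OF c_nonzero[OF False]] c_order by (simp add: multiplier_funpow)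
qed

text \<open>Since \<open>f ^^ m\<close> is the identity, \<open>f ^^ (m - 1)\<close> is a two-sided
  inverse.\<close>

lemma multiplier_bij: "bij f"
proof -
  obtain n where n: "m = Suc n"
    using multiplier_order_pos gr0_implies_Suc by blast
  show ?thesis
  proof (rule o_bij)
    show "(f ^^ n) \<circ> f = id" "f \<circ> (f ^^ n) = id"
      using multiplier_funpow_order by (auto simp: n fun_eq_iff funpow_swap1)
  qed
qed

text \<open>For nonzero \<open>x\<close> the inverse of \<open>c x\<close> is its power
  \<open>m - 1\<close>, so the claimed preimage is an iterate of \<open>f\<close> at
  \<open>x\<close>, and one more application closes the cycle.\<close>

lemma multiplier_inv: "inv f = (\<lambda>x. inverse (c x) * x)"
proof
  fix x
  obtain n where n: "m = Suc n"
    using multiplier_order_pos gr0_implies_Suc by blast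
  have "f (inverse (c x) * x) = x"
  proof (cases "x = 0")
    case False
    have "c x * c x ^ n = 1"
      using power_mult_order[OF c_nonzero[OF False]] c_order[OF False] by (simp add: n)
    then have "inverse (c x) = c x ^ n"
      by (rule inverse_unique)
    then have "inverse (c x) * x = (f ^^ n) x"
      using False by (simp add: multiplier_funpow)
    then have "f (inverse (c x) * x) = (f ^^ m) x"
      by (simp add: n)
    then show ?thesis
      by (simp add: multiplier_funpow_order)
  qed (simp add: f_eq)
  then show "inv f x = inverse (c x) * x"
    using multiplier_bij by (metis bij_inv_eq_iff)
qed

text \<open>\<open>orbit\<close> collects only the positive iterates, so the return to
  \<open>x\<close> after \<open>m > 0\<close> steps is needed.\<close>

lemma multiplier_orbit_self: "x \<in> orbit f x"
  using multiplier_funpow_order[of x] multiplier_order_pos unfolding orbit_altdef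
  by (metis (mono_tags, lifting) mem_Collect_eq)

lemma multiplier_card_orbit:
  assumes "x \<noteq> 0"
  shows "card (orbit f x) = m"
proof -
  have "orbit f x = (\<lambda>k. (f ^^ k) x) ` {..<m}"
    using orbit_altdef_bounded[OF multiplier_funpow_order multiplier_order_pos] by auto
  moreover have "inj_on (\<lambda>k. (f ^^ k) x) {..<m}"
    using inj_on_power_mult_order[OF c_nonzero[OF assms]] assms c_order[OF assms]
    by (simp add: multiplier_funpow inj_on_def)
  ultimately show ?thesis
    by (simp add: card_image)
qed

text \<open>The orbits of nonzero points partition a set of \<open>m * d\<close> elements into
  blocks of size \<open>m\<close>, so there are \<open>d\<close> of them; the remaining orbit is
  \<open>{0}\<close>.\<close>

lemma multiplier_cycle_type:
  assumes "CARD('a) - 1 = m * d"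
  shows "cycle_type f = {#1#} + replicate_mset d m"
proof -
  define C where "C = orbit f ` (UNIV - {0})"
  have orbit_eq: "orbit f x = orbit f y" if "x \<in> orbit f y" for x y
  proof -
    have "y \<in> orbit f x"
      using multiplier_orbit_self that by (rule orbit_swap)
    with that show ?thesis
      by (meson orbit_trans subsetI subset_antisym)
  qed
  have orbit_0: "orbit f 0 = {0}"
    by (simp add: orbit_eq_singleton_iff f_eq)
  have zero_notin: "0 \<notin> orbit f x" if "x \<noteq> 0" for x
    using that orbit_eq[of 0 x] multiplier_orbit_self[of x] orbit_0 by auto
  have Union_C: "\<Union>C = UNIV - {0}"
    unfolding C_def using zero_notin multiplier_orbit_self by auto
  have card_in_C: "card A = m" if "A \<in> C" for A
    using that multiplier_card_orbit by (auto simp: C_def)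
  have "m * card C = card (\<Union>C)"
  proof (rule card_partition)
    show "A \<inter> B = {}" if AB: "A \<in> C" "B \<in> C" "A \<noteq> B" for A B
    proof -
      obtain a b where "A = orbit f a" "B = orbit f b"
        using AB by (auto simp: C_def)
      then show ?thesis
        using AB(3) orbit_eq by blast
    qed
  qed (auto simp: card_in_C)
  also have "\<dots> = m * d"
    using assms by (simp add: Union_C card_Diff_singleton)
  finally have card_C: "card C = d"
    using multiplier_order_pos by simp
  have "range (orbit f) = insert {0} C"
    using orbit_0 by (auto simp: C_def)
  \<comment> \<open>Even for \<open>m = 1\<close> the orbit of 0 is a new element, so it contributes
    its own separate cycle of length one.\<close>
  moreover have "{0} \<notin> C"
    using Union_C by blast
  moreover have "image_mset card (mset_set C) = replicate_mset d m"
  proof -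
    have "image_mset card (mset_set C) = image_mset (\<lambda>_. m) (mset_set C)"
      by (intro image_mset_cong) (simp add: card_in_C)
    then show ?thesis
      by (simp add: image_mset_const_eq card_C)
  qed
  ultimately show ?thesis
    by (simp add: cycle_type_def)
qed

end

section \<open>Application to \<open>x G(x^l)\<close>\<close>

theorem mainTheorem5:
  fixes r p e q m d l :: nat
    and \<zeta> :: "'a :: {field, finite}"
    and u :: "nat \<Rightarrow> 'a"
  assumes "r > 1"
    and "prime p" and "odd p" and "e \<ge> 1" and "q = p ^ e"
    and "CARD('a) = q"
    and "[q = 1] (mod r)"
    and "\<zeta> \<noteq> 0" and "mult_order \<zeta> = r"
    and "m > 0" and "d > 0" and "q - 1 = m * d"
    and "r dvd d"
    and "totient m \<ge> r"
    and "\<And>k. k < r \<Longrightarrow> u k \<noteq> 0"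
    and "\<And>k. k < r \<Longrightarrow> mult_order (u k) = m"
    and "l = (q - 1) div r"
  shows "(\<exists>!G. interpolates_roots r \<zeta> u G) \<and>
    (\<exists>!G'. interpolates_roots r \<zeta> (\<lambda>k. inverse (u k)) G') \<and>
    (\<forall>G f. interpolates_roots r \<zeta> u G \<longrightarrow> f = x_times_poly_pow l G \<longrightarrow>
       permutation_poly f \<and>
       cycle_type (poly f) = {#1#} + replicate_mset d m \<and>
       (\<forall>G'. interpolates_roots r \<zeta> (\<lambda>k. inverse (u k)) G' \<longrightarrow>
          inv (poly f) = poly (x_times_poly_pow l G')))"
proof -
  define c where "c = (\<lambda>G (x :: 'a). poly G (x ^ l))"
  have card: "CARD('a) - 1 = m * d" and \<zeta>: "\<zeta> \<noteq> 0" "mult_order \<zeta> = r"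
    using assms by auto
  obtain t where t: "d = r * t"
    using \<open>r dvd d\<close> by auto
  \<comment> \<open>Here \<open>r dvd d\<close> enters: it makes \<open>l\<close> a multiple of
    \<open>m\<close>, whence every \<open>u k\<close> has trivial \<open>l\<close>-th power.\<close>
  have l: "l = m * t"
    using assms(1,12,17) by (simp add: t)
  have root: "\<exists>k<r. x ^ l = \<zeta> ^ k" if "x \<noteq> 0" for x
  proof -
    \<comment> \<open>The exponent \<open>l * r\<close> is \<open>CARD('a) - 1\<close>.\<close>
    have "(x ^ l) ^ r = 1"
      using finite_field_power_card_minus_1[OF that] card
      by (simp add: l t mult_ac flip: power_mult)
    then show ?thesis
      using root_of_unity_eq_power[of \<zeta> "x ^ l"] \<zeta> by metis
  qed
  have u: "u k ^ l = 1" if "k < r" for k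
    using power_mult_order[OF assms(15)[OF that]] assms(16)[OF that] by (simp add: l power_mult)
  have main: "permutation_poly f \<and> cycle_type (poly f) = {#1#} + replicate_mset d m \<and>
      (\<forall>G'. interpolates_roots r \<zeta> (\<lambda>k. inverse (u k)) G' \<longrightarrow>
        inv (poly f) = poly (x_times_poly_pow l G'))"
    if G: "interpolates_roots r \<zeta> u G" and f: "f = x_times_poly_pow l G" for G f
  proof -
    have c_eq: "\<exists>k<r. x ^ l = \<zeta> ^ k \<and> c G x = u k" if "x \<noteq> 0" for x
      using root[OF that] G by (auto simp: c_def interpolates_roots_def)
    have f_eq: "poly f x = c G x * x" for x
      by (simp add: f poly_x_times_poly_pow c_def)
    have nonzero: "c G x \<noteq> 0" and order: "mult_order (c G x) = m"
      and invariant: "c G (c G x * x) = c G x" if x: "x \<noteq> 0" for x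
    proof -
      obtain k where k: "k < r" "c G x = u k"
        using c_eq[OF x] by auto
      show "c G x \<noteq> 0" "mult_order (c G x) = m"
        using k assms(15,16) by auto
      \<comment> \<open>The factor \<open>c G\<close> depends on its argument only through the
        \<open>l\<close>-th power, so this yields its invariance.\<close>
      have "(c G x * x) ^ l = x ^ l"
        using u[OF k(1)] by (simp add: k(2) power_mult_distrib)
      then show "c G (c G x * x) = c G x"
        unfolding c_def by simp
    qed
    note multiplier = f_eq nonzero order invariant
    have "inv (poly f) = poly (x_times_poly_pow l G')"
      if G': "interpolates_roots r \<zeta> (\<lambda>k. inverse (u k)) G'" for G'
    proof
      fix x
      \<comment> \<open>For nonzero \<open>x\<close> the same index \<open>k\<close> governs both
        polynomials, and \<open>G'\<close> takes the value \<open>inverse (u k)\<close> at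
        \<open>x ^ l\<close>; at 0 both sides vanish.\<close>
      have "inverse (c G x) * x = x * poly G' (x ^ l)"
      proof (cases "x = 0")
        case False
        then obtain k where "k < r" "x ^ l = \<zeta> ^ k" "c G x = u k"
          using c_eq by blast
        then show ?thesis
          using G' by (simp add: interpolates_roots_def)
      qed simp
      then show "inv (poly f) x = poly (x_times_poly_pow l G') x"
        using multiplier_inv[of "poly f" "c G" m] multiplier by (simp add: poly_x_times_poly_pow)
    qed
    moreover have "bij (poly f)"
      using multiplier_bij[of "poly f" "c G" m] multiplier by blast
    moreover have "cycle_type (poly f) = {#1#} + replicate_mset d m"
      using multiplier_cycle_type[of "poly f" "c G" m d] multiplier card by blast
    ultimately show ?thesis
      by (simp add: permutation_poly_def)
  qed
  show ?thesis
    by (intro conjI allI impI) (use ex1_interpolates_roots[OF \<zeta>] main in blast)+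
qed

end
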